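(* Let $z,z'$ be admissible parameters. Let $s^*_{UD_n}(r)$ be the maximal separation distance after $r$ iterations of the down-up chain (corresponding to the z-measure with parameters $z,z'$) on the $n$th level of the Young lattice, and let $s^*_{DU_n}(r)$ be the corresponding quantity for the up-down chain on the $n$th level. Then $$s^*_{DU_n}(r)=s^*_{UD_{n+1}}(r+1)$$ for all $n\ge1$, $r\ge0$.
   Context: Partitions are identified with their Young diagrams. Write $\tau\nearrow\lambda$ if the diagram of $\lambda$ is obtained from that of $\tau$ by adding one box. The content of the box $b=(i,j)$ (row $i$, column $j$) is $c(b)=j-i$. $d_\lambda$ denotes the dimension of the irreducible representation of the symmetric group indexed by $\lambda$ (the number of standard Young tableaux of shape $\lambda$). Parameters $z,z'$ are admissible if either $z'=\bar z$ with $z\in\mathbb{C}\setminus\mathbb{R}$, or $z,z'$ are real and there is $m\in\mathbb{Z}$ with $m<z,z'<m+1$. The z-measure on partitions $\lambda$ of $n$ is $$M_n(\lambda)=\frac{\prod_{b\in\lambda}(z+c(b))(z'+c(b))}{zz'(zz'+1)\cdots(zz'+n-1)}\,\frac{d_\lambda^2}{n!}.$$ The down chain moves from a partition $\lambda$ of $n$ to a partition $\tau$ of $n-1$ with $\tau\nearrow\lambda$ with probability $d_\tau/d_\lambda$. The up chain moves from a partition $\tau$ of $n-1$ to a partition $\rho$ of $n$ with $\tau\nearrow\rho$ with probability $\frac{d_\tau M_n(\rho)}{d_\rho M_{n-1}(\tau)}$. The down-up chain on level $n$ (partitions of $n$) takes one down step followed by one up step; the up-down chain on level $n$ takes one up step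 (to level $n+1$) followed by one down step. Both have stationary distribution $M_n$. For a Markov chain $K$ on a finite set with stationary distribution $\pi$, the maximal separation distance is $s^*(r)=\max_{x,y}\left[1-\frac{K^r(x,y)}{\pi(y)}\right]$. *)

theory Defs
  imports Complex_Main "HOL-Library.FuncSet"
begin

section \<open>Young diagrams\<close>

text \<open>
  A partition is represented by its Young diagram, a finite set of boxes (row, column).
  Rows and columns are counted from 0; contents, being differences, are unaffected.  The identification is
  spelled out in \<open>young_diagram_iff_partition\<close> below.
\<close>

type_synonym box = "nat \<times> nat"

definition young_diagram :: "box set \<Rightarrow> bool" where
  "young_diagram \<mu> \<longleftrightarrow> finite \<mu> \<and>
     (\<forall>i j i' j'. (i, j) \<in> \<mu> \<longrightarrow> i' \<le> i \<longrightarrow> j' \<le> j \<longrightarrow> (i', j') \<in> \<mu>)"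

definition partitions_of :: "nat \<Rightarrow> box set set" where
  "partitions_of n = {\<mu>. young_diagram \<mu> \<and> card \<mu> = n}"

lemma young_diagram_iff_partition:
  "\<mu> \<in> partitions_of n \<longleftrightarrow>
    (\<exists>p :: nat \<Rightarrow> nat. antimono p \<and> finite {i. p i \<noteq> 0} \<and> (\<Sum>i | p i \<noteq> 0. p i) = n \<and>
       \<mu> = {(i, j). j < p i})"
proof
  assume "\<mu> \<in> partitions_of n"
  then have fin: "finite \<mu>" and cd: "card \<mu> = n"
    and down: "\<And>i j i' j'. (i, j) \<in> \<mu> \<Longrightarrow> i' \<le> i \<Longrightarrow> j' \<le> j \<Longrightarrow> (i', j') \<in> \<mu>"
    by (auto simp: partitions_of_def young_diagram_def)
  define R where "R i = {j. (i, j) \<in> \<mu>}" for i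
  have finR: "finite (R i)" for i
    by (rule finite_subset[of _ "snd ` \<mu>"]) (use fin in \<open>force simp: R_def\<close>)+
  have R_eq: "R i = {..<card (R i)}" for i
  proof -
    define m where "m = (LEAST k. k \<notin> R i)"
    have "\<exists>k. k \<notin> R i"
      using finR[of i] ex_new_if_finite infinite_UNIV_nat by blast
    then have m: "m \<notin> R i" unfolding m_def by (rule LeastI_ex)
    have "k \<in> R i" if "k < m" for k
      using not_less_Least[of k "\<lambda>k. k \<notin> R i"] that by (auto simp: m_def)
    moreover have "k < m" if "k \<in> R i" for k
      using that m down[of i k i m] by (force simp: R_def not_less[symmetric])
    ultimately have "R i = {..<m}" by auto
    then show ?thesis by simp
  qed
  define p where "p i = card (R i)" for i
  have mem: "(i, j) \<in> \<mu> \<longleftrightarrow> j < p i" for i j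
    using R_eq[of i] unfolding p_def R_def by blast
  have eq: "\<mu> = {(i, j). j < p i}"
    using mem by auto
  have "antimono p"
    unfolding p_def
    by (rule antimonoI, rule card_mono[OF finR]) (auto simp: R_def intro: down)
  moreover have fp: "finite {i. p i \<noteq> 0}"
  proof (rule finite_subset[of _ "fst ` \<mu>"])
    show "{i. p i \<noteq> 0} \<subseteq> fst ` \<mu>"
      using mem by (force simp: image_iff)
  qed (use fin in simp)
  moreover have "\<mu> = (SIGMA i:{i. p i \<noteq> 0}. {..<p i})"
    unfolding eq by auto
  then have "(\<Sum>i | p i \<noteq> 0. p i) = n"
    using cd fp by simp
  ultimately show "\<exists>p :: nat \<Rightarrow> nat. antimono p \<and> finite {i. p i \<noteq> 0} \<and>
      (\<Sum>i | p i \<noteq> 0. p i) = n \<and> \<mu> = {(i, j). j < p i}"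
    using eq by blast
next
  assume "\<exists>p :: nat \<Rightarrow> nat. antimono p \<and> finite {i. p i \<noteq> 0} \<and>
      (\<Sum>i | p i \<noteq> 0. p i) = n \<and> \<mu> = {(i, j). j < p i}"
  then obtain p :: "nat \<Rightarrow> nat" where anti: "antimono p" and fp: "finite {i. p i \<noteq> 0}"
    and sum: "(\<Sum>i | p i \<noteq> 0. p i) = n" and eq: "\<mu> = {(i, j). j < p i}"
    by blast
  have sig: "\<mu> = (SIGMA i:{i. p i \<noteq> 0}. {..<p i})"
    unfolding eq by auto
  have "finite \<mu>" "card \<mu> = n"
    unfolding sig using fp sum by auto
  moreover have "(i', j') \<in> \<mu>" if "(i, j) \<in> \<mu>" "i' \<le> i" "j' \<le> j" for i j i' j'
    using that antimonoD[OF anti, of i' i] by (auto simp: eq)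
  ultimately show "\<mu> \<in> partitions_of n"
    by (auto simp: partitions_of_def young_diagram_def)
qed

lemma finite_partitions_of: "finite (partitions_of n)"
proof (rule finite_subset)
  show "partitions_of n \<subseteq> Pow ({..<n} \<times> {..<n})"
  proof clarify
    fix \<mu> i j assume "\<mu> \<in> partitions_of n" and ij: "(i, j) \<in> \<mu>"
    then have fin: "finite \<mu>" and cd: "card \<mu> = n"
      and down: "\<And>i' j'. i' \<le> i \<Longrightarrow> j' \<le> j \<Longrightarrow> (i', j') \<in> \<mu>"
      unfolding partitions_of_def young_diagram_def by blast+
    have "{..i} \<times> {..j} \<subseteq> \<mu>"
      using down by auto
    then have "card ({..i} \<times> {..j}) \<le> n"
      using card_mono[OF fin] cd by blast
    then have "Suc i * Suc j \<le> n"
      by (simp add: card_cartesian_product)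
    then show "i \<in> {..<n} \<and> j \<in> {..<n}"
      by auto
  qed
qed simp

lemma partitions_of_nonempty: "partitions_of n \<noteq> {}"
proof -
  have "{0} \<times> {..<n} \<in> partitions_of n"
    by (auto simp: partitions_of_def young_diagram_def card_cartesian_product)
  then show ?thesis by blast
qed

definition covers :: "box set \<Rightarrow> box set \<Rightarrow> bool"  (infix "\<nearrow>" 50) where
  "\<tau> \<nearrow> \<mu> \<longleftrightarrow> young_diagram \<tau> \<and> young_diagram \<mu> \<and> (\<exists>b. b \<notin> \<tau> \<and> \<mu> = insert b \<tau>)"

definition box_content :: "box \<Rightarrow> int" where
  "box_content b = int (snd b) - int (fst b)"

text \<open>Tableaux are extensional functions, so that each filling is counted once.\<close>

definition standard_tableaux :: "box set \<Rightarrow> (box \<Rightarrow> nat) set" where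
  "standard_tableaux \<mu> =
     {T \<in> extensional \<mu>. bij_betw T \<mu> {1..card \<mu>} \<and>
        (\<forall>i j. (i, Suc j) \<in> \<mu> \<longrightarrow> T (i, j) < T (i, Suc j)) \<and>
        (\<forall>i j. (Suc i, j) \<in> \<mu> \<longrightarrow> T (i, j) < T (Suc i, j))}"

definition syt_dim :: "box set \<Rightarrow> nat" where
  "syt_dim \<mu> = card (standard_tableaux \<mu>)"


section \<open>The z-measure\<close>

definition admissible :: "complex \<Rightarrow> complex \<Rightarrow> bool" where
  "admissible z z' \<longleftrightarrow>
     (z \<notin> \<real> \<and> z' = cnj z) \<or>
     (\<exists>x x' :: real. \<exists>m :: int. z = of_real x \<and> z' = of_real x' \<and>
        of_int m < x \<and> x < of_int m + 1 \<and> of_int m < x' \<and> x' < of_int m + 1)"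

definition z_weight :: "complex \<Rightarrow> complex \<Rightarrow> nat \<Rightarrow> box set \<Rightarrow> complex" where
  "z_weight z z' n \<mu> =
     (\<Prod>b\<in>\<mu>. (z + of_int (box_content b)) * (z' + of_int (box_content b))) / pochhammer (z * z') n
       * ((of_nat (syt_dim \<mu>))\<^sup>2 / fact n)"

text \<open>
  For admissible parameters the weight is a real number (lemma \<open>of_real_z_measure\<close> below),
  so taking the real part only changes the type.
\<close>

definition z_measure :: "complex \<Rightarrow> complex \<Rightarrow> nat \<Rightarrow> box set \<Rightarrow> real" where
  "z_measure z z' n \<mu> = Re (z_weight z z' n \<mu>)"

lemma of_real_z_measure:
  assumes "admissible z z'"
  shows "complex_of_real (z_measure z z' n \<mu>) = z_weight z z' n \<mu>"
proof -
  have factor: "(z + of_int c) * (z' + of_int c) \<in> \<real>" for c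
    using assms unfolding admissible_def
  proof (elim disjE conjE exE)
    assume "z' = cnj z"
    then have "z' + of_int c = cnj (z + of_int c)" by simp
    then show ?thesis by (metis Reals_of_real complex_mult_cnj)
  qed auto
  have "z * z' \<in> \<real>"
    using factor[of 0] by simp
  then have "pochhammer (z * z') n \<in> \<real>"
    by (auto simp: pochhammer_prod intro!: prod_in_Reals Reals_add)
  moreover have "(fact n :: complex) \<in> \<real>"
    by (metis Reals_of_nat of_nat_fact)
  ultimately have "z_weight z z' n \<mu> \<in> \<real>"
    unfolding z_weight_def
    by (intro Reals_mult Reals_divide Reals_power prod_in_Reals factor) auto
  then show ?thesis
    by (simp add: z_measure_def of_real_Re)
qed


section \<open>Down-up and up-down chains\<close>

definition down_prob :: "box set \<Rightarrow> box set \<Rightarrow> real" where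
  "down_prob \<mu> \<tau> = (if \<tau> \<nearrow> \<mu> then real (syt_dim \<tau>) / real (syt_dim \<mu>) else 0)"

text \<open>Here \<open>n\<close> is the size of \<open>\<tau>\<close>; the step leads from level \<open>n\<close> to level \<open>n + 1\<close>.\<close>

definition up_prob :: "complex \<Rightarrow> complex \<Rightarrow> nat \<Rightarrow> box set \<Rightarrow> box set \<Rightarrow> real" where
  "up_prob z z' n \<tau> \<rho> =
     (if \<tau> \<nearrow> \<rho> then real (syt_dim \<tau>) * z_measure z z' (n + 1) \<rho> /
        (real (syt_dim \<rho>) * z_measure z z' n \<tau>)
      else 0)"

text \<open>Only meaningful for \<open>n \<ge> 1\<close>.\<close>

definition down_up :: "complex \<Rightarrow> complex \<Rightarrow> nat \<Rightarrow> box set \<Rightarrow> box set \<Rightarrow> real" where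
  "down_up z z' n \<mu> \<rho> = (\<Sum>\<tau>\<in>partitions_of (n - 1). down_prob \<mu> \<tau> * up_prob z z' (n - 1) \<tau> \<rho>)"

definition up_down :: "complex \<Rightarrow> complex \<Rightarrow> nat \<Rightarrow> box set \<Rightarrow> box set \<Rightarrow> real" where
  "up_down z z' n \<mu> \<rho> = (\<Sum>\<tau>\<in>partitions_of (n + 1). up_prob z z' n \<mu> \<tau> * down_prob \<tau> \<rho>)"


section \<open>Maximal separation distance\<close>

fun kernel_power :: "'a set \<Rightarrow> ('a \<Rightarrow> 'a \<Rightarrow> real) \<Rightarrow> nat \<Rightarrow> 'a \<Rightarrow> 'a \<Rightarrow> real" where
  "kernel_power S K 0 x y = (if x = y then 1 else 0)"
| "kernel_power S K (Suc r) x y = (\<Sum>u\<in>S. K x u * kernel_power S K r u y)"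

text \<open>For a chain on the finite nonempty state space \<open>S\<close> with stationary distribution \<open>\<pi>\<close>.\<close>

definition max_separation :: "'a set \<Rightarrow> ('a \<Rightarrow> 'a \<Rightarrow> real) \<Rightarrow> ('a \<Rightarrow> real) \<Rightarrow> nat \<Rightarrow> real" where
  "max_separation S K \<pi> r = Max ((\<lambda>(x, y). 1 - kernel_power S K r x y / \<pi> y) ` (S \<times> S))"

text \<open>
  The subscripts follow the operator convention (rightmost step first): \<open>UD\<close> denotes the
  down-up chain and \<open>DU\<close> the up-down chain.
\<close>

definition sep_UD :: "complex \<Rightarrow> complex \<Rightarrow> nat \<Rightarrow> nat \<Rightarrow> real" where
  "sep_UD z z' n r = max_separation (partitions_of n) (down_up z z' n) (z_measure z z' n) r"

definition sep_DU :: "complex \<Rightarrow> complex \<Rightarrow> nat \<Rightarrow> nat \<Rightarrow> real" where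
  "sep_DU z z' n r = max_separation (partitions_of n) (up_down z z' n) (z_measure z z' n) r"

end

theory Submission
  imports Defs
begin

text \<open>
  Let \<open>D\<close> and \<open>U\<close> be the down and up kernels between levels \<open>n\<close> and \<open>n + 1\<close>.  By detailed balance,
  the density \<open>(D (U D)^r U)(x, y) / M(y)\<close> of the down-up chain on level \<open>n + 1\<close> is the average of the
  density of \<open>(U D)^r\<close> at \<open>(s, t)\<close>, where \<open>s\<close> and \<open>t\<close> arise from independent down steps out of \<open>x\<close>
  and \<open>y\<close>.  Hence its minimum is at least that of the up-down chain on level \<open>n\<close>, with equality if
  the latter is attained at the one-row and one-column diagrams, since down steps out of those are
  deterministic.  That this pair is minimising follows by induction on \<open>n\<close>: summing
  \<open>(z + c)(z' + c)\<close> over addable and over removable boxes gives the commutation relation that the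
  up-down kernel is a nonnegative combination of the down-up kernel and the identity, so that a power
  of the up-down kernel is a nonnegative combination of powers of the down-up kernel, and these
  reduce to the level below.
\<close>

section \<open>Addable and removable boxes\<close>

definition addable :: "box set \<Rightarrow> box set" where
  "addable \<mu> = {b. b \<notin> \<mu> \<and> young_diagram (insert b \<mu>)}"

definition removable :: "box set \<Rightarrow> box set" where
  "removable \<mu> = {b \<in> \<mu>. young_diagram (\<mu> - {b})}"

lemma young_diagramD:
  "young_diagram \<mu> \<Longrightarrow> (i, j) \<in> \<mu> \<Longrightarrow> i' \<le> i \<Longrightarrow> j' \<le> j \<Longrightarrow> (i', j') \<in> \<mu>"
  unfolding young_diagram_def by blast

lemma young_diagram_finite: "young_diagram \<mu> \<Longrightarrow> finite \<mu>"
  by (simp add: young_diagram_def)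

lemma addable_iff:
  assumes "young_diagram \<mu>"
  shows "(i, j) \<in> addable \<mu> \<longleftrightarrow>
    (i, j) \<notin> \<mu> \<and> (i = 0 \<or> (i - 1, j) \<in> \<mu>) \<and> (j = 0 \<or> (i, j - 1) \<in> \<mu>)"
proof
  assume "(i, j) \<in> addable \<mu>"
  then have *: "(i, j) \<notin> \<mu>" "young_diagram (insert (i, j) \<mu>)"
    by (auto simp: addable_def)
  have "(i - 1, j) \<in> insert (i, j) \<mu>" "(i, j - 1) \<in> insert (i, j) \<mu>"
    by (rule young_diagramD[OF *(2), of i j]; simp)+
  then show "(i, j) \<notin> \<mu> \<and> (i = 0 \<or> (i - 1, j) \<in> \<mu>) \<and> (j = 0 \<or> (i, j - 1) \<in> \<mu>)"
    using * by auto
next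
  assume *: "(i, j) \<notin> \<mu> \<and> (i = 0 \<or> (i - 1, j) \<in> \<mu>) \<and> (j = 0 \<or> (i, j - 1) \<in> \<mu>)"
  have "(i', j') \<in> insert (i, j) \<mu>" if "i' \<le> i" "j' \<le> j" for i' j'
  proof -
    have "i' = i \<and> j' = j \<or> i' \<le> i - 1 \<and> i \<noteq> 0 \<or> j' \<le> j - 1 \<and> j \<noteq> 0"
      using that by linarith
    then show ?thesis
      using * that young_diagramD[OF assms] by blast
  qed
  then have "young_diagram (insert (i, j) \<mu>)"
    using assms unfolding young_diagram_def by blast
  then show "(i, j) \<in> addable \<mu>"
    using * by (simp add: addable_def)
qed

lemma removable_iff:
  assumes "young_diagram \<mu>"
  shows "(i, j) \<in> removable \<mu> \<longleftrightarrow> (i, j) \<in> \<mu> \<and> (Suc i, j) \<notin> \<mu> \<and> (i, Suc j) \<notin> \<mu>"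
proof
  assume "(i, j) \<in> removable \<mu>"
  then have *: "(i, j) \<in> \<mu>" "young_diagram (\<mu> - {(i, j)})"
    by (auto simp: removable_def)
  show "(i, j) \<in> \<mu> \<and> (Suc i, j) \<notin> \<mu> \<and> (i, Suc j) \<notin> \<mu>"
    using *(1) young_diagramD[OF *(2), of "Suc i" j i j] young_diagramD[OF *(2), of i "Suc j" i j]
    by auto
next
  assume *: "(i, j) \<in> \<mu> \<and> (Suc i, j) \<notin> \<mu> \<and> (i, Suc j) \<notin> \<mu>"
  have "(i', j') = (i, j)" if "(i', j') \<in> \<mu>" "i \<le> i'" "j \<le> j'" for i' j'
  proof (rule ccontr)
    assume "(i', j') \<noteq> (i, j)"
    then have "Suc i \<le> i' \<or> Suc j \<le> j'"
      using that by auto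
    then show False
      using * that young_diagramD[OF assms that(1)] by blast
  qed
  then have "young_diagram (\<mu> - {(i, j)})"
    using assms unfolding young_diagram_def by blast
  then show "(i, j) \<in> removable \<mu>"
    using * by (simp add: removable_def)
qed

section \<open>The covering relation between consecutive levels in terms of boxes\<close>

lemma covers_insertI: "young_diagram \<tau> \<Longrightarrow> young_diagram (insert b \<tau>) \<Longrightarrow> b \<notin> \<tau> \<Longrightarrow> \<tau> \<nearrow> insert b \<tau>"
  unfolding covers_def by blast

lemma covers_removeI: "young_diagram \<mu> \<Longrightarrow> young_diagram (\<mu> - {b}) \<Longrightarrow> b \<in> \<mu> \<Longrightarrow> \<mu> - {b} \<nearrow> \<mu>"
  using covers_insertI[of "\<mu> - {b}" b] by (simp add: insert_absorb)

lemma covered_eq_image_removable: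
  assumes "young_diagram \<mu>"
  shows "{\<tau>. \<tau> \<nearrow> \<mu>} = (\<lambda>b. \<mu> - {b}) ` removable \<mu>"
  using assms by (auto simp: covers_def removable_def image_iff insert_absorb)

lemma covering_eq_image_addable:
  assumes "young_diagram \<mu>"
  shows "{\<tau>. \<mu> \<nearrow> \<tau>} = (\<lambda>b. insert b \<mu>) ` addable \<mu>"
  using assms by (auto simp: covers_def addable_def image_iff)

lemma inj_on_remove: "inj_on (\<lambda>b. \<mu> - {b}) (removable \<mu>)"
  by (auto simp: inj_on_def removable_def)

lemma inj_on_insert: "inj_on (\<lambda>b. insert b \<mu>) (addable \<mu>)"
  by (auto simp: inj_on_def addable_def)

lemma partitions_ofD: "\<mu> \<in> partitions_of n \<Longrightarrow> young_diagram \<mu>"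
  by (simp add: partitions_of_def)

lemma covers_levelD:
  "\<tau> \<nearrow> \<mu> \<Longrightarrow> \<mu> \<in> partitions_of (Suc n) \<Longrightarrow> \<tau> \<in> partitions_of n"
  "\<tau> \<nearrow> \<mu> \<Longrightarrow> \<tau> \<in> partitions_of n \<Longrightarrow> \<mu> \<in> partitions_of (Suc n)"
  by (auto simp: covers_def partitions_of_def dest: young_diagram_finite)

lemma partitions_covered:
  "\<mu> \<in> partitions_of (Suc n) \<Longrightarrow> {\<tau> \<in> partitions_of n. \<tau> \<nearrow> \<mu>} = (\<lambda>b. \<mu> - {b}) ` removable \<mu>"
  by (subst covered_eq_image_removable[symmetric]) (auto intro: covers_levelD partitions_ofD)

lemma partitions_covering:
  "\<mu> \<in> partitions_of n \<Longrightarrow> {\<tau> \<in> partitions_of (Suc n). \<mu> \<nearrow> \<tau>} = (\<lambda>b. insert b \<mu>) ` addable \<mu>"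
  by (subst covering_eq_image_addable[symmetric]) (auto intro: covers_levelD partitions_ofD)

lemma sum_indicator_subset:
  fixes f :: "'a \<Rightarrow> real"
  assumes "finite B" "A \<subseteq> B"
  shows "(\<Sum>b\<in>B. f b * of_bool (b \<in> A)) = sum f A"
proof -
  have "(\<Sum>b\<in>B. f b * of_bool (b \<in> A)) = (\<Sum>b\<in>B \<inter> A. f b)"
    using assms(1) by (simp add: sum.inter_restrict of_bool_def if_distrib cong: if_cong)
  then show ?thesis
    using assms(2) by (simp add: Int_absorb1)
qed

text \<open>
  Around each lattice vertex, the four adjacent cells detect addable and removable corners:
  an alternating sum of their indicators is 1 at an addable box, -1 at a removable one, and the
  vertex at the origin contributes an additional -1.
\<close>

lemma sum_addable_content:
  fixes f :: "int \<Rightarrow> real"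
  assumes yd: "young_diagram \<mu>"
  shows "(\<Sum>b\<in>addable \<mu>. f (box_content b)) = (\<Sum>b\<in>removable \<mu>. f (box_content b)) + f 0 +
    (\<Sum>b\<in>\<mu>. f (box_content b + 1) + f (box_content b - 1) - 2 * f (box_content b))"
proof -
  \<comment> \<open>Translates of \<open>\<mu>\<close> to the right, down and along the diagonal
    shift contents by +1, -1 and 0; reindexing them produces the second difference of
    \<open>f\<close>. Removable boxes are also moved diagonally, which keeps their contents.\<close>
  define R where "R = (\<lambda>(i, j). (i, Suc j)) ` \<mu>"
  define C where "C = (\<lambda>(i, j). (Suc i, j)) ` \<mu>"
  define G where "G = (\<lambda>(i, j). (Suc i, Suc j)) ` \<mu>"
  define Q where "Q = (\<lambda>(i, j). (Suc i, Suc j)) ` removable \<mu>"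
  define B where "B = \<mu> \<union> R \<union> C \<union> G \<union> {(0, 0)} \<union> addable \<mu> \<union> Q"
  define g where "g b = f (box_content b)" for b
  have fin: "finite \<mu>" using yd by (rule young_diagram_finite)
  \<comment> \<open>An addable box is the origin or adjoins a box of \<open>\<mu>\<close>, so it
    ranges over a finite set; this makes the common index set \<open>B\<close> finite.\<close>
  have "addable \<mu> \<subseteq> {(0, 0)} \<union> R \<union> C"
  proof
    fix b assume "b \<in> addable \<mu>"
    then show "b \<in> {(0, 0)} \<union> R \<union> C"
      by (cases b; cases "fst b"; cases "snd b")
        (force simp: addable_iff[OF yd] R_def C_def image_iff)+
  qed
  moreover have "removable \<mu> \<subseteq> \<mu>" by (auto simp: removable_def)
  ultimately have finB: "finite B"
    unfolding B_def using fin
    by (auto simp: R_def C_def G_def Q_def intro: finite_subset finite_imageI)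
  have memR: "(i, j) \<in> R \<longleftrightarrow> j \<noteq> 0 \<and> (i, j - 1) \<in> \<mu>" for i j
    by (cases j) (force simp: R_def image_iff)+
  have memC: "(i, j) \<in> C \<longleftrightarrow> i \<noteq> 0 \<and> (i - 1, j) \<in> \<mu>" for i j
    by (cases i) (force simp: C_def image_iff)+
  have memG: "(i, j) \<in> G \<longleftrightarrow> i \<noteq> 0 \<and> j \<noteq> 0 \<and> (i - 1, j - 1) \<in> \<mu>" for i j
    by (cases i; cases j) (force simp: G_def image_iff)+
  have memQ: "(i, j) \<in> Q \<longleftrightarrow> i \<noteq> 0 \<and> j \<noteq> 0 \<and> (i - 1, j - 1) \<in> removable \<mu>" for i j
    by (cases i; cases j) (force simp: Q_def image_iff)+
  \<comment> \<open>Only the membership pattern of \<open>b\<close> and its left, upper and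
    upper-left neighbours matters, and the diagram property leaves few patterns.\<close>
  have local: "of_bool (b \<in> R) + of_bool (b \<in> C) - of_bool (b \<in> G) - of_bool (b \<in> \<mu>)
      = of_bool (b \<in> addable \<mu>) - of_bool (b \<in> Q) - (of_bool (b \<in> {(0, 0)}) :: real)" for b
  proof -
    obtain i j where b: "b = (i, j)" by (cases b)
    note D = young_diagramD[OF yd]
    have "(i, j) \<in> \<mu> \<Longrightarrow> (i - 1, j) \<in> \<mu>" "(i, j) \<in> \<mu> \<Longrightarrow> (i, j - 1) \<in> \<mu>"
      "(i - 1, j) \<in> \<mu> \<Longrightarrow> (i - 1, j - 1) \<in> \<mu>" "(i, j - 1) \<in> \<mu> \<Longrightarrow> (i - 1, j - 1) \<in> \<mu>"
      by (erule D; simp)+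
    then show ?thesis
      unfolding b memR memC memG memQ addable_iff[OF yd] removable_iff[OF yd]
      by (cases i; cases j) auto
  qed
  have "(\<Sum>b\<in>B. g b * (of_bool (b \<in> R) + of_bool (b \<in> C) - of_bool (b \<in> G) - of_bool (b \<in> \<mu>)))
      = (\<Sum>b\<in>B. g b * (of_bool (b \<in> addable \<mu>) - of_bool (b \<in> Q) - of_bool (b \<in> {(0, 0)})))"
    by (simp only: local)
  then have "sum g R + sum g C - sum g G - sum g \<mu> = sum g (addable \<mu>) - sum g Q - sum g {(0, 0)}"
    unfolding right_diff_distrib distrib_left sum_subtractf sum.distrib
    by (subst (asm) (1 2 3 4 5 6 7) sum_indicator_subset[OF finB]) (auto simp: B_def)
  moreover have "sum g R = (\<Sum>b\<in>\<mu>. f (box_content b + 1))"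
    unfolding R_def by (subst sum.reindex) (auto simp: inj_on_def g_def box_content_def
        algebra_simps intro!: sum.cong)
  moreover have "sum g C = (\<Sum>b\<in>\<mu>. f (box_content b - 1))"
    unfolding C_def by (subst sum.reindex) (auto simp: inj_on_def g_def box_content_def
        algebra_simps intro!: sum.cong)
  moreover have "sum g G = (\<Sum>b\<in>\<mu>. f (box_content b))"
    unfolding G_def by (subst sum.reindex) (auto simp: inj_on_def g_def box_content_def
        intro!: sum.cong)
  moreover have "sum g Q = (\<Sum>b\<in>removable \<mu>. f (box_content b))"
    unfolding Q_def by (subst sum.reindex) (auto simp: inj_on_def g_def box_content_def
        intro!: sum.cong)
  ultimately show ?thesis
    by (simp add: g_def box_content_def sum.distrib sum_subtractf flip: sum_distrib_left)
qed

section \<open>The branching rule for standard tableaux\<close>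

lemma standard_tableaux_finite:
  assumes "finite \<mu>"
  shows "finite (standard_tableaux \<mu>)"
proof (rule finite_subset)
  show "standard_tableaux \<mu> \<subseteq> PiE \<mu> (\<lambda>_. {1..card \<mu>})"
    unfolding standard_tableaux_def PiE_def bij_betw_def by blast
  show "finite (PiE \<mu> (\<lambda>_. {1..card \<mu>}))"
    using assms by (intro finite_PiE) simp_all
qed

text \<open>A removable box has no neighbour to the right or below, so the largest entry placed
  there violates no inequality, and the other entries form a tableau of the smaller shape.\<close>

lemma standard_tableaux_insert:
  assumes yd: "young_diagram \<mu>" and b: "b \<in> removable \<mu>"
  shows "{T \<in> standard_tableaux \<mu>. T b = card \<mu>} =
    (\<lambda>T. T(b := card \<mu>)) ` standard_tableaux (\<mu> - {b})"
proof -
  obtain p q where pq: "b = (p, q)" by (cases b)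
  have bm: "b \<in> \<mu>" and cR: "(p, Suc q) \<notin> \<mu>" and cC: "(Suc p, q) \<notin> \<mu>"
    using b by (auto simp: pq removable_iff[OF yd])
  have fin: "finite \<mu>" using yd by (rule young_diagram_finite)
  have card: "card \<mu> = Suc (card (\<mu> - {b}))"
    using fin bm by (simp only: card_Suc_Diff1)
  have top: "card \<mu> \<in> {1..card \<mu>}"
    unfolding card by simp
  have D: "(i, j) \<in> \<mu>" if "(i, Suc j) \<in> \<mu> \<or> (Suc i, j) \<in> \<mu>" for i j
    using that young_diagramD[OF yd, of i "Suc j" i j] young_diagramD[OF yd, of "Suc i" j i j] by auto
  have sets: "{1..card \<mu>} - {card \<mu>} = {1..card (\<mu> - {b})}"
    using card by auto
  show ?thesis
  proof (intro equalityI subsetI)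
    fix T assume "T \<in> {T \<in> standard_tableaux \<mu>. T b = card \<mu>}"
    then have T: "T \<in> extensional \<mu>" "bij_betw T \<mu> {1..card \<mu>}" "T b = card \<mu>"
      and rows: "\<And>i j. (i, Suc j) \<in> \<mu> \<Longrightarrow> T (i, j) < T (i, Suc j)"
      and cols: "\<And>i j. (Suc i, j) \<in> \<mu> \<Longrightarrow> T (i, j) < T (Suc i, j)"
      by (auto simp: standard_tableaux_def)
    let ?S = "restrict T (\<mu> - {b})"
    have "bij_betw T {b} {card \<mu>}" using T(3) by (simp add: bij_betw_def)
    from bij_betw_DiffI[OF T(2) this] have "bij_betw T (\<mu> - {b}) ({1..card \<mu>} - {card \<mu>})"
      using bm top by blast
    then have "bij_betw ?S (\<mu> - {b}) {1..card (\<mu> - {b})}"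
      unfolding sets by (subst bij_betw_cong[of _ _ T]) auto
    moreover have "?S (i, j) < ?S (i, Suc j)" if "(i, Suc j) \<in> \<mu> - {b}" for i j
      using that rows[of i j] D[of i j] cR by (auto simp: pq)
    moreover have "?S (i, j) < ?S (Suc i, j)" if "(Suc i, j) \<in> \<mu> - {b}" for i j
      using that cols[of i j] D[of i j] cC by (auto simp: pq)
    ultimately have "?S \<in> standard_tableaux (\<mu> - {b})"
      unfolding standard_tableaux_def by blast
    moreover have "T = ?S(b := card \<mu>)"
      using T(1,3) by (auto simp: fun_eq_iff extensional_def)
    ultimately show "T \<in> (\<lambda>T. T(b := card \<mu>)) ` standard_tableaux (\<mu> - {b})"
      by blast
  next
    fix T assume "T \<in> (\<lambda>T. T(b := card \<mu>)) ` standard_tableaux (\<mu> - {b})"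
    then obtain S where T_eq: "T = S(b := card \<mu>)" and S: "S \<in> extensional (\<mu> - {b})"
      "bij_betw S (\<mu> - {b}) {1..card (\<mu> - {b})}"
      and rows: "\<And>i j. (i, Suc j) \<in> \<mu> - {b} \<Longrightarrow> S (i, j) < S (i, Suc j)"
      and cols: "\<And>i j. (Suc i, j) \<in> \<mu> - {b} \<Longrightarrow> S (i, j) < S (Suc i, j)"
      by (auto simp: standard_tableaux_def)
    have lt: "S x < card \<mu>" if "x \<in> \<mu>" "x \<noteq> b" for x
      using bij_betwE[OF S(2), rule_format, of x] that card by simp
    have "bij_betw T (\<mu> - {b}) ({1..card \<mu>} - {card \<mu>})"
      unfolding sets using S(2) by (subst bij_betw_cong[of _ _ S]) (simp_all add: T_eq)
    moreover have "T b = card \<mu>" by (simp add: T_eq)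
    moreover have "bij_betw T {b} {card \<mu>}" by (simp add: T_eq bij_betw_def)
    ultimately have "bij_betw T (\<mu> - {b} \<union> {b}) ({1..card \<mu>} - {card \<mu>} \<union> {card \<mu>})"
      by (intro bij_betw_combine) auto
    moreover have "\<mu> - {b} \<union> {b} = \<mu>" "{1..card \<mu>} - {card \<mu>} \<union> {card \<mu>} = {1..card \<mu>}"
      using bm card by auto
    ultimately have "bij_betw T \<mu> {1..card \<mu>}" by simp
    moreover have "T \<in> extensional \<mu>"
      using S(1) bm by (auto simp: T_eq extensional_def)
    moreover have "T (i, j) < T (i, Suc j)" if "(i, Suc j) \<in> \<mu>" for i j
      using that rows[of i j] lt[of "(i, j)"] D[of i j] cR by (auto simp: T_eq pq)
    moreover have "T (i, j) < T (Suc i, j)" if "(Suc i, j) \<in> \<mu>" for i j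
      using that cols[of i j] lt[of "(i, j)"] D[of i j] cC by (auto simp: T_eq pq)
    ultimately show "T \<in> {T \<in> standard_tableaux \<mu>. T b = card \<mu>}"
      by (auto simp: standard_tableaux_def T_eq)
  qed
qed

text \<open>The largest entry sits at a removable box, since a right or lower neighbour would need a
  larger one. Its position splits the tableaux into disjoint classes.\<close>

lemma syt_dim_branching:
  assumes yd: "young_diagram \<mu>" and ne: "\<mu> \<noteq> {}"
  shows "syt_dim \<mu> = (\<Sum>b\<in>removable \<mu>. syt_dim (\<mu> - {b}))"
proof -
  have fin: "finite \<mu>" using yd by (rule young_diagram_finite)
  let ?A = "\<lambda>b. {T \<in> standard_tableaux \<mu>. T b = card \<mu>}"
  have "\<exists>b\<in>removable \<mu>. T b = card \<mu>" if "T \<in> standard_tableaux \<mu>" for T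
  proof -
    have T: "bij_betw T \<mu> {1..card \<mu>}"
      and rows: "\<And>i j. (i, Suc j) \<in> \<mu> \<Longrightarrow> T (i, j) < T (i, Suc j)"
      and cols: "\<And>i j. (Suc i, j) \<in> \<mu> \<Longrightarrow> T (i, j) < T (Suc i, j)"
      using that by (auto simp: standard_tableaux_def)
    have "card \<mu> \<in> {1..card \<mu>}"
      using fin ne by (simp add: Suc_le_eq card_gt_0_iff)
    then obtain p q where b: "(p, q) \<in> \<mu>" "T (p, q) = card \<mu>"
      using T unfolding bij_betw_def by (metis imageE surj_pair)
    have le: "x \<in> \<mu> \<Longrightarrow> T x \<le> card \<mu>" for x
      using T bij_betwE by fastforce
    have "(p, Suc q) \<notin> \<mu>" "(Suc p, q) \<notin> \<mu>"
      using rows[of p q] cols[of p q] b(2) le by fastforce+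
    then show ?thesis
      using b by (intro bexI[of _ "(p, q)"]) (auto simp: removable_iff[OF yd])
  qed
  then have "standard_tableaux \<mu> = (\<Union>b\<in>removable \<mu>. ?A b)"
    by blast
  moreover have "card (\<Union>b\<in>removable \<mu>. ?A b) = (\<Sum>b\<in>removable \<mu>. card (?A b))"
  proof (rule card_UN_disjoint)
    show "finite (removable \<mu>)" using fin by (simp add: removable_def)
    show "\<forall>b\<in>removable \<mu>. finite (?A b)" using standard_tableaux_finite[OF fin] by simp
    show "\<forall>b\<in>removable \<mu>. \<forall>b'\<in>removable \<mu>. b \<noteq> b' \<longrightarrow> ?A b \<inter> ?A b' = {}"
    proof (intro ballI impI)
      fix b b' assume "b \<in> removable \<mu>" "b' \<in> removable \<mu>" "b \<noteq> b'"
      then have "b \<in> \<mu>" "b' \<in> \<mu>" by (auto simp: removable_def)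
      then show "?A b \<inter> ?A b' = {}"
        using \<open>b \<noteq> b'\<close> unfolding standard_tableaux_def bij_betw_def inj_on_def by force
    qed
  qed
  moreover have "card (?A b) = syt_dim (\<mu> - {b})" if "b \<in> removable \<mu>" for b
  proof -
    have "inj_on (\<lambda>T. T(b := card \<mu>)) (standard_tableaux (\<mu> - {b}))"
    proof (rule inj_onI)
      fix S T assume S: "S \<in> standard_tableaux (\<mu> - {b})" and T: "T \<in> standard_tableaux (\<mu> - {b})"
        and eq: "S(b := card \<mu>) = T(b := card \<mu>)"
      \<comment> \<open>Extensionality fixes the overwritten value at \<open>b\<close>, so the
        update loses no information.\<close>
      have "S \<in> extensional (\<mu> - {b})" "T \<in> extensional (\<mu> - {b})"
        using S T unfolding standard_tableaux_def by blast+
      then have "S b = undefined" "T b = undefined"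
        by (auto intro: extensional_arb)
      then show "S = T"
        using eq by (metis fun_upd_triv fun_upd_upd)
    qed
    then show ?thesis
      unfolding standard_tableaux_insert[OF yd that] syt_dim_def by (rule card_image)
  qed
  ultimately show ?thesis by (simp add: syt_dim_def)
qed

lemma removable_nonempty:
  assumes yd: "young_diagram \<mu>" and ne: "\<mu> \<noteq> {}"
  shows "removable \<mu> \<noteq> {}"
proof -
  \<comment> \<open>A box maximising row plus column is removable: its right and lower neighbours
    would have a larger sum.\<close>
  let ?S = "(\<lambda>b. fst b + snd b) ` \<mu>"
  have "finite ?S" "?S \<noteq> {}"
    using young_diagram_finite[OF yd] ne by auto
  then have "Max ?S \<in> ?S" by (rule Max_in)
  then obtain p q where pq: "(p, q) \<in> \<mu>" "Max ?S = p + q"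
    by (metis (no_types, lifting) fst_conv imageE snd_conv surj_pair)
  have "i + j \<le> p + q" if "(i, j) \<in> \<mu>" for i j
    unfolding pq(2)[symmetric] using \<open>finite ?S\<close> that by (force intro: Max_ge)
  then have "(p, q) \<in> removable \<mu>"
    using pq(1) by (fastforce simp: removable_iff[OF yd])
  then show ?thesis by blast
qed

lemma syt_dim_pos: "\<mu> \<in> partitions_of n \<Longrightarrow> syt_dim \<mu> > 0"
proof (induction n arbitrary: \<mu>)
  case 0
  then have "\<mu> = {}"
    by (auto simp: partitions_of_def dest: young_diagram_finite)
  \<comment> \<open>The empty diagram has exactly one tableau, the extensional function on the empty
    set.\<close>
  then have "standard_tableaux \<mu> = {\<lambda>_. undefined}"
    by (auto simp: standard_tableaux_def bij_betw_def)
  then show ?case by (simp add: syt_dim_def)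
next
  case (Suc n)
  then have yd: "young_diagram \<mu>" and ne: "\<mu> \<noteq> {}"
    by (auto simp: partitions_of_def)
  obtain b where b: "b \<in> removable \<mu>" using removable_nonempty[OF yd ne] by blast
  have "\<mu> - {b} \<in> partitions_of n"
    using partitions_covered[OF Suc.prems] b by blast
  then have "syt_dim (\<mu> - {b}) > 0" by (rule Suc.IH)
  moreover have "finite (removable \<mu>)"
    using young_diagram_finite[OF yd] by (simp add: removable_def)
  ultimately show ?case
    unfolding syt_dim_branching[OF yd ne] using b by (metis (no_types, lifting) gr0I sum_eq_0_iff)
qed

section \<open>The down kernel: total mass and deterministic steps\<close>

lemma sum_down_prob:
  assumes \<mu>: "\<mu> \<in> partitions_of (Suc n)"
  shows "(\<Sum>\<tau>\<in>partitions_of n. down_prob \<mu> \<tau>) = 1"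
proof -
  have yd: "young_diagram \<mu>" and ne: "\<mu> \<noteq> {}"
    using \<mu> by (auto simp: partitions_of_def)
  have "(\<Sum>\<tau>\<in>partitions_of n. down_prob \<mu> \<tau>) =
      (\<Sum>\<tau> | \<tau> \<in> partitions_of n \<and> \<tau> \<nearrow> \<mu>. real (syt_dim \<tau>) / real (syt_dim \<mu>))"
    by (simp add: down_prob_def sum.inter_filter finite_partitions_of)
  also have "\<dots> = (\<Sum>b\<in>removable \<mu>. real (syt_dim (\<mu> - {b})) / real (syt_dim \<mu>))"
    unfolding partitions_covered[OF \<mu>] by (subst sum.reindex[OF inj_on_remove]) simp
  also have "\<dots> = real (syt_dim \<mu>) / real (syt_dim \<mu>)"
    by (simp add: syt_dim_branching[OF yd ne] flip: sum_divide_distrib)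
  finally show ?thesis using syt_dim_pos[OF \<mu>] by simp
qed

lemma down_prob_nonneg: "down_prob \<mu> \<tau> \<ge> 0"
  by (simp add: down_prob_def)

text \<open>If \<open>b\<close> dominates all boxes in both coordinates, no other box
  \<open>c\<close> is removable, because \<open>b\<close> would survive without the box
  \<open>c\<close> above or left of it.\<close>

lemma down_prob_deterministic:
  assumes \<mu>: "\<mu> \<in> partitions_of (Suc n)" and b: "b \<in> \<mu>"
    and top: "\<And>i j. (i, j) \<in> \<mu> \<Longrightarrow> i \<le> fst b \<and> j \<le> snd b"
    and \<tau>: "\<tau> \<in> partitions_of n"
  shows "down_prob \<mu> \<tau> = of_bool (\<tau> = \<mu> - {b})"
proof -
  have yd: "young_diagram \<mu>" using \<mu> by (rule partitions_ofD)
  have "c = b" if "c \<in> removable \<mu>" for c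
  proof (rule ccontr)
    assume "c \<noteq> b"
    then have "b \<in> \<mu> - {c}" using b by simp
    moreover have "young_diagram (\<mu> - {c})" "c \<in> \<mu>" using that by (auto simp: removable_def)
    ultimately show False
      using top[of "fst c" "snd c"] young_diagramD[of "\<mu> - {c}" "fst b" "snd b" "fst c" "snd c"]
      by auto
  qed
  then have "removable \<mu> = {b}"
    using removable_nonempty[OF yd] b by blast
  then have eq: "{\<tau> \<in> partitions_of n. \<tau> \<nearrow> \<mu>} = {\<mu> - {b}}"
    using partitions_covered[OF \<mu>] by simp
  then have iff: "\<tau> \<nearrow> \<mu> \<longleftrightarrow> \<tau> = \<mu> - {b}" if "\<tau> \<in> partitions_of n" for \<tau>
    using that by blast
  have mem: "\<mu> - {b} \<in> partitions_of n" using eq by blast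
  \<comment> \<open>The probability of the only possible step is read off from the total mass,
    without computing any dimension.\<close>
  have "1 = (\<Sum>\<tau>\<in>partitions_of n. if \<tau> = \<mu> - {b} then down_prob \<mu> \<tau> else 0)"
    unfolding sum_down_prob[OF \<mu>, symmetric]
    by (rule sum.cong) (auto simp: iff down_prob_def)
  then have "down_prob \<mu> (\<mu> - {b}) = 1"
    using mem by (simp add: finite_partitions_of)
  then show ?thesis using \<tau> by (auto simp: down_prob_def iff)
qed

section \<open>Transition probabilities for the z-measure\<close>

text \<open>The factor that a box of content \<open>c\<close> contributes to the z-measure. At
  \<open>c = 0\<close> it is the base of the Pochhammer symbol in the normalisation.\<close>

definition content_weight :: "complex \<Rightarrow> complex \<Rightarrow> int \<Rightarrow> real" where
  "content_weight z z' c = Re ((z + of_int c) * (z' + of_int c))"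

lemma of_real_content_weight:
  assumes "admissible z z'"
  shows "complex_of_real (content_weight z z' c) = (z + of_int c) * (z' + of_int c)"
  using assms unfolding admissible_def content_weight_def
  by (auto simp: complex_eq_iff algebra_simps)

text \<open>In the conjugate case this is a squared modulus of a nonreal number. In the real case
  both factors lie between the same consecutive integers and hence have the same sign.\<close>

lemma content_weight_pos:
  assumes "admissible z z'"
  shows "content_weight z z' c > 0"
  using assms unfolding admissible_def
proof (elim disjE conjE exE)
  assume z: "z \<notin> \<real>" "z' = cnj z"
  have "Im z \<noteq> 0" using z(1) by (simp add: complex_is_Real_iff)
  then have "(Re z + of_int c)\<^sup>2 + (Im z)\<^sup>2 > 0"
    by (simp add: sum_power2_gt_zero_iff)
  then show ?thesis
    by (simp add: content_weight_def z(2) power2_eq_square)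
next
  fix x x' :: real and m :: int
  assume z: "z = of_real x" "z' = of_real x'" and
    b: "of_int m < x" "x < of_int m + 1" "of_int m < x'" "x' < of_int m + 1"
  have "(x + of_int c) * (x' + of_int c) > 0"
  proof (cases "m + c \<ge> 0")
    case True
    then have "real_of_int m + of_int c \<ge> 0" by linarith
    then show ?thesis using b by (intro mult_pos_pos) linarith+
  next
    case False
    then have "real_of_int m + of_int c + 1 \<le> 0" by linarith
    then show ?thesis using b by (intro mult_neg_neg) linarith+
  qed
  then show ?thesis by (simp add: content_weight_def z)
qed

lemma content_weight_quadratic:
  "content_weight z z' c = content_weight z z' 0 + of_int c * Re (z + z') + (of_int c)\<^sup>2"
  by (simp add: content_weight_def algebra_simps power2_eq_square)

text \<open>The weight is a monic quadratic in \<open>c\<close>; the constant second difference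
  makes the corner sums below depend on the diagram only through its size.\<close>

lemma content_weight_second_difference:
  "content_weight z z' (c + 1) + content_weight z z' (c - 1) - 2 * content_weight z z' c = 2"
  by (subst (1 2 3) content_weight_quadratic) (simp add: algebra_simps power2_eq_square)

lemma z_measure_eq:
  assumes adm: "admissible z z'"
  shows "z_measure z z' n \<mu> = (\<Prod>b\<in>\<mu>. content_weight z z' (box_content b)) /
    pochhammer (content_weight z z' 0) n * ((real (syt_dim \<mu>))\<^sup>2 / fact n)"
proof -
  have "z * z' = of_real (content_weight z z' 0)"
    using of_real_content_weight[OF adm, of 0] by simp
  then have "z_weight z z' n \<mu> = of_real ((\<Prod>b\<in>\<mu>. content_weight z z' (box_content b)) /
    pochhammer (content_weight z z' 0) n * ((real (syt_dim \<mu>))\<^sup>2 / fact n))"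
    by (simp add: z_weight_def of_real_content_weight[OF adm] flip: pochhammer_of_real)
  then show ?thesis unfolding z_measure_def by (simp only: Re_complex_of_real)
qed

lemma z_measure_pos:
  assumes adm: "admissible z z'" and \<mu>: "\<mu> \<in> partitions_of n"
  shows "z_measure z z' n \<mu> > 0"
  unfolding z_measure_eq[OF adm] using syt_dim_pos[OF \<mu>] content_weight_pos[OF adm]
  by (auto intro!: mult_pos_pos divide_pos_pos prod_pos pochhammer_pos)

lemma z_measure_insert:
  assumes adm: "admissible z z'" and \<mu>: "\<mu> \<in> partitions_of n" and b: "b \<in> addable \<mu>"
  shows "z_measure z z' (Suc n) (insert b \<mu>) / z_measure z z' n \<mu> =
    content_weight z z' (box_content b) * (real (syt_dim (insert b \<mu>)))\<^sup>2 /
    ((content_weight z z' 0 + n) * Suc n * (real (syt_dim \<mu>))\<^sup>2)"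
proof -
  have "finite \<mu>" "b \<notin> \<mu>"
    using \<mu> b by (auto simp: addable_def partitions_of_def dest: young_diagram_finite)
  moreover have "(\<Prod>b\<in>\<mu>. content_weight z z' (box_content b)) > 0"
    using content_weight_pos[OF adm] by (simp add: prod_pos)
  moreover have "pochhammer (content_weight z z' 0) n > 0"
    using content_weight_pos[OF adm] by (simp add: pochhammer_pos)
  ultimately show ?thesis
    unfolding z_measure_eq[OF adm] using syt_dim_pos[OF \<mu>] content_weight_pos[OF adm, of 0]
    by (simp add: pochhammer_Suc divide_simps del: prod_zero_iff)
qed

text \<open>In the ratio of z-measures everything cancels except the factor of the new box, the last
  normalising factors and the dimensions.\<close>

lemma up_prob_insert:
  assumes adm: "admissible z z'" and \<mu>: "\<mu> \<in> partitions_of n" and b: "b \<in> addable \<mu>"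
  shows "up_prob z z' n \<mu> (insert b \<mu>) = content_weight z z' (box_content b) *
    real (syt_dim (insert b \<mu>)) / ((content_weight z z' 0 + n) * Suc n * real (syt_dim \<mu>))"
proof -
  have cov: "\<mu> \<nearrow> insert b \<mu>"
    using \<mu> b by (auto simp: addable_def partitions_of_def intro: covers_insertI)
  then have "insert b \<mu> \<in> partitions_of (Suc n)" using \<mu> by (rule covers_levelD)
  then have d: "syt_dim \<mu> > 0" "syt_dim (insert b \<mu>) > 0" using \<mu> by (auto intro: syt_dim_pos)
  have "up_prob z z' n \<mu> (insert b \<mu>) = real (syt_dim \<mu>) / real (syt_dim (insert b \<mu>)) *
      (z_measure z z' (Suc n) (insert b \<mu>) / z_measure z z' n \<mu>)"
    using cov by (simp add: up_prob_def)
  then show ?thesis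
    unfolding z_measure_insert[OF assms] using d by (simp add: power2_eq_square)
qed

text \<open>This trades an up step into \<open>\<mu>\<close> for a down step out of
  \<open>\<mu>\<close>, at the price of changing the level of the measure.\<close>

lemma detailed_balance:
  assumes adm: "admissible z z'" and "\<tau> \<in> partitions_of n" "\<mu> \<in> partitions_of (Suc n)"
  shows "up_prob z z' n \<tau> \<mu> / z_measure z z' (Suc n) \<mu> = down_prob \<mu> \<tau> / z_measure z z' n \<tau>"
  using z_measure_pos[OF adm assms(2)] z_measure_pos[OF adm assms(3)]
  by (simp add: up_prob_def down_prob_def)

section \<open>The commutation relation\<close>

text \<open>The dimension of the intermediate diagram cancels between the two steps, leaving a
  prefactor that depends only on the endpoints and the level.\<close>

lemma up_down_eq_sum:
  assumes adm: "admissible z z'" and \<mu>: "\<mu> \<in> partitions_of n"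
  shows "up_down z z' n \<mu> \<rho> = real (syt_dim \<rho>) / (real (syt_dim \<mu>) * Suc n *
    (content_weight z z' 0 + n)) *
    (\<Sum>b\<in>addable \<mu>. if \<rho> \<nearrow> insert b \<mu> then content_weight z z' (box_content b) else 0)"
proof -
  have "up_down z z' n \<mu> \<rho> =
      (\<Sum>\<tau> | \<tau> \<in> partitions_of (Suc n) \<and> \<mu> \<nearrow> \<tau>. up_prob z z' n \<mu> \<tau> * down_prob \<tau> \<rho>)"
    unfolding up_down_def
    by (intro sum.mono_neutral_cong_right) (auto simp: finite_partitions_of up_prob_def)
  also have "\<dots> = (\<Sum>b\<in>addable \<mu>. up_prob z z' n \<mu> (insert b \<mu>) * down_prob (insert b \<mu>) \<rho>)"
    unfolding partitions_covering[OF \<mu>] by (subst sum.reindex[OF inj_on_insert]) simp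
  also have "\<dots> = (\<Sum>b\<in>addable \<mu>. real (syt_dim \<rho>) / (real (syt_dim \<mu>) * Suc n *
    (content_weight z z' 0 + n)) *
    (if \<rho> \<nearrow> insert b \<mu> then content_weight z z' (box_content b) else 0))"
  proof (rule sum.cong)
    fix b assume b: "b \<in> addable \<mu>"
    then have "insert b \<mu> \<in> partitions_of (Suc n)" using partitions_covering[OF \<mu>] by blast
    then have "syt_dim (insert b \<mu>) > 0" by (rule syt_dim_pos)
    then show "up_prob z z' n \<mu> (insert b \<mu>) * down_prob (insert b \<mu>) \<rho> =
      real (syt_dim \<rho>) / (real (syt_dim \<mu>) * Suc n * (content_weight z z' 0 + n)) *
      (if \<rho> \<nearrow> insert b \<mu> then content_weight z z' (box_content b) else 0)"
      unfolding up_prob_insert[OF adm \<mu> b] by (simp add: down_prob_def mult_ac)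
  qed simp
  finally show ?thesis by (simp only: sum_distrib_left)
qed

text \<open>Again the intermediate dimension cancels. The sum runs over boxes of the target because
  the up step ends by adding \<open>b\<close>.\<close>

lemma down_up_eq_sum:
  assumes adm: "admissible z z'" and \<mu>: "\<mu> \<in> partitions_of (Suc n)"
    and \<rho>: "\<rho> \<in> partitions_of (Suc n)"
  shows "down_up z z' (Suc n) \<mu> \<rho> = real (syt_dim \<rho>) / (real (syt_dim \<mu>) * Suc n *
    (content_weight z z' 0 + n)) *
    (\<Sum>b\<in>removable \<rho>. if \<rho> - {b} \<nearrow> \<mu> then content_weight z z' (box_content b) else 0)"
proof -
  have "down_up z z' (Suc n) \<mu> \<rho> =
      (\<Sum>\<tau> | \<tau> \<in> partitions_of n \<and> \<tau> \<nearrow> \<rho>. down_prob \<mu> \<tau> * up_prob z z' n \<tau> \<rho>)"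
    unfolding down_up_def
    by (intro sum.mono_neutral_cong_right) (auto simp: finite_partitions_of up_prob_def)
  also have "\<dots> = (\<Sum>b\<in>removable \<rho>. down_prob \<mu> (\<rho> - {b}) * up_prob z z' n (\<rho> - {b}) \<rho>)"
    unfolding partitions_covered[OF \<rho>] by (subst sum.reindex[OF inj_on_remove]) simp
  also have "\<dots> = (\<Sum>b\<in>removable \<rho>. real (syt_dim \<rho>) / (real (syt_dim \<mu>) * Suc n *
    (content_weight z z' 0 + n)) *
    (if \<rho> - {b} \<nearrow> \<mu> then content_weight z z' (box_content b) else 0))"
  proof (rule sum.cong)
    fix b assume b: "b \<in> removable \<rho>"
    then have mem: "\<rho> - {b} \<in> partitions_of n" using partitions_covered[OF \<rho>] by blast
    have ins: "insert b (\<rho> - {b}) = \<rho>" and add: "b \<in> addable (\<rho> - {b})"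
      using b partitions_ofD[OF \<rho>] by (auto simp: removable_def addable_def insert_absorb)
    show "down_prob \<mu> (\<rho> - {b}) * up_prob z z' n (\<rho> - {b}) \<rho> =
      real (syt_dim \<rho>) / (real (syt_dim \<mu>) * Suc n * (content_weight z z' 0 + n)) *
      (if \<rho> - {b} \<nearrow> \<mu> then content_weight z z' (box_content b) else 0)"
      using up_prob_insert[OF adm mem add, unfolded ins] syt_dim_pos[OF mem]
      by (simp add: down_prob_def mult_ac)
  qed simp
  finally show ?thesis by (simp only: sum_distrib_left)
qed

lemma sum_content_weight:
  assumes \<mu>: "\<mu> \<in> partitions_of n"
  shows "(\<Sum>b\<in>addable \<mu>. content_weight z z' (box_content b)) =
    (\<Sum>b\<in>removable \<mu>. content_weight z z' (box_content b)) + content_weight z z' 0 + 2 * n"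
  using \<mu> by (subst sum_addable_content)
    (auto simp: partitions_of_def content_weight_second_difference)

text \<open>Between distinct diagrams of equal size the intermediate diagram can only be the union
  on the way up and the intersection on the way down. Both exist under the same condition, and in
  both cases \<open>b\<close> is the box of \<open>\<rho>\<close> missing from
  \<open>\<mu>\<close>.\<close>

lemma sum_addable_eq_sum_removable:
  fixes f :: "box \<Rightarrow> real"
  assumes \<mu>: "\<mu> \<in> partitions_of n" and \<rho>: "\<rho> \<in> partitions_of n" and ne: "\<mu> \<noteq> \<rho>"
  shows "(\<Sum>b\<in>addable \<mu>. if \<rho> \<nearrow> insert b \<mu> then f b else 0) =
    (\<Sum>b\<in>removable \<rho>. if \<rho> - {b} \<nearrow> \<mu> then f b else 0)"
proof -
  have yd: "young_diagram \<mu>" "young_diagram \<rho>" and fin: "finite \<mu>" "finite \<rho>"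
    using \<mu> \<rho> by (auto simp: partitions_of_def dest: young_diagram_finite)
  have union: "young_diagram (\<mu> \<union> \<rho>)" and inter: "young_diagram (\<mu> \<inter> \<rho>)"
    using yd unfolding young_diagram_def by blast+
  have "{b \<in> addable \<mu>. \<rho> \<nearrow> insert b \<mu>} = {b \<in> removable \<rho>. \<rho> - {b} \<nearrow> \<mu>}"
  proof (intro equalityI subsetI)
    fix b assume "b \<in> {b \<in> addable \<mu>. \<rho> \<nearrow> insert b \<mu>}"
    then obtain c where b: "b \<notin> \<mu>" and c: "c \<notin> \<rho>" "insert b \<mu> = insert c \<rho>"
      by (auto simp: addable_def covers_def)
    have "b \<noteq> c" using c b ne by (metis insert_ident)
    then have "b \<in> \<rho>" using c(2) by blast
    moreover have \<mu>_eq: "\<mu> = insert c (\<rho> - {b})"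
      using b c(2) \<open>b \<noteq> c\<close> by (metis Diff_insert_absorb insert_Diff_if singletonD)
    moreover have "\<rho> - {b} = \<mu> \<inter> \<rho>"
      using c(1) by (subst \<mu>_eq) blast
    ultimately show "b \<in> {b \<in> removable \<rho>. \<rho> - {b} \<nearrow> \<mu>}"
      using inter yd c(1) covers_insertI[of "\<rho> - {b}" c] by (auto simp: removable_def)
  next
    fix b assume "b \<in> {b \<in> removable \<rho>. \<rho> - {b} \<nearrow> \<mu>}"
    then obtain c where b: "b \<in> \<rho>" and c: "c \<notin> \<rho> - {b}" "\<mu> = insert c (\<rho> - {b})"
      by (auto simp: removable_def covers_def)
    have "b \<noteq> c" using c b ne by auto
    then have "insert b \<mu> = \<mu> \<union> \<rho>" "insert b \<mu> = insert c \<rho>" "b \<notin> \<mu>" "c \<notin> \<rho>"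
      using c b by auto
    then show "b \<in> {b \<in> addable \<mu>. \<rho> \<nearrow> insert b \<mu>}"
      using union yd covers_insertI[of \<rho> c] by (simp add: addable_def)
  qed
  moreover have "finite (removable \<rho>)" using fin by (simp add: removable_def)
  \<comment> \<open>Addable boxes inject into the finite next level.\<close>
  moreover have "finite (addable \<mu>)"
  proof (rule finite_imageD[OF _ inj_on_insert])
    show "finite ((\<lambda>b. insert b \<mu>) ` addable \<mu>)"
      by (subst partitions_covering[OF \<mu>, symmetric]) (simp add: finite_partitions_of)
  qed
  ultimately show ?thesis by (simp flip: sum.inter_filter)
qed

text \<open>Off the diagonal the two box sums agree and only the prefactors differ. On the diagonal
  they are the full sums over addable and removable boxes, whose difference
  \<open>t + 2 * Suc n\<close> yields the identity term.\<close>

lemma commutation_relation: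
  fixes t :: real
  assumes adm: "admissible z z'" and \<mu>: "\<mu> \<in> partitions_of (Suc n)"
    and \<rho>: "\<rho> \<in> partitions_of (Suc n)"
  defines "t \<equiv> content_weight z z' 0"
  shows "up_down z z' (Suc n) \<mu> \<rho> =
    Suc n * (t + n) / ((Suc n + 1) * (t + Suc n)) * down_up z z' (Suc n) \<mu> \<rho> +
    (t + 2 * Suc n) / ((Suc n + 1) * (t + Suc n)) * of_bool (\<mu> = \<rho>)"
proof -
  have t: "t > 0" unfolding t_def by (rule content_weight_pos[OF adm])
  have d: "real (syt_dim \<mu>) > 0" using syt_dim_pos[OF \<mu>] by simp
  show ?thesis
  proof (cases "\<mu> = \<rho>")
    case False
    have nz: "t + n \<noteq> 0" "t + Suc n \<noteq> 0" using t by linarith+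
    show ?thesis
      unfolding up_down_eq_sum[OF adm \<mu>] down_up_eq_sum[OF adm \<mu> \<rho>]
        sum_addable_eq_sum_removable[OF \<mu> \<rho> False] t_def[symmetric]
      using False nz d by (simp add: divide_simps)
  next
    case True
    have yd: "young_diagram \<mu>" using \<mu> by (rule partitions_ofD)
    define A where "A = (\<Sum>b\<in>addable \<mu>. content_weight z z' (box_content b))"
    define R where "R = (\<Sum>b\<in>removable \<mu>. content_weight z z' (box_content b))"
    have "(\<Sum>b\<in>addable \<mu>. if \<mu> \<nearrow> insert b \<mu> then content_weight z z' (box_content b) else 0) = A"
      unfolding A_def using yd by (intro sum.cong) (auto simp: addable_def intro: covers_insertI)
    moreover have "(\<Sum>b\<in>removable \<mu>. if \<mu> - {b} \<nearrow> \<mu> then content_weight z z' (box_content b) else 0) = R"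
      unfolding R_def using yd
      by (intro sum.cong) (auto simp: removable_def intro: covers_removeI)
    moreover have "A = R + t + 2 * Suc n"
      unfolding A_def R_def t_def by (rule sum_content_weight[OF \<mu>])
    moreover have "t + n > 0" "t + Suc n > 0" using t by linarith+
    ultimately show ?thesis
      unfolding True[symmetric] up_down_eq_sum[OF adm \<mu>] down_up_eq_sum[OF adm \<mu> \<mu>] t_def[symmetric]
      using d by (simp add: divide_simps)
  qed
qed

section \<open>Powers of kernels\<close>

text \<open>This is the associativity identity (D U)^(r+1) = D (U D)^r U, proved by splitting off
  the first factor D U.\<close>

lemma kernel_power_factor:
  fixes U :: "'b \<Rightarrow> 'a \<Rightarrow> real"
  assumes fin: "finite A" "finite B" and y: "y \<in> A"
  shows "kernel_power A (\<lambda>x y. \<Sum>s\<in>B. D x s * U s y) (Suc r) x y =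
    (\<Sum>s\<in>B. D x s * (\<Sum>t\<in>B. kernel_power B (\<lambda>s t. \<Sum>u\<in>A. U s u * D u t) r s t * U t y))"
proof (induction r arbitrary: x)
  case 0
  have "(\<Sum>t\<in>B. (if s = t then 1 else 0) * U t y) = U s y" if "s \<in> B" for s
    using that fin by (simp add: if_distribR if_distrib cong: if_cong)
  then show ?case
    using fin y by (simp add: if_distrib cong: if_cong)
next
  case (Suc r)
  \<comment> \<open>\<open>V\<close> is the column at \<open>y\<close> of (U D)^r U, so the
    induction hypothesis replaces the remaining power by D applied to \<open>V\<close>.\<close>
  define V where "V s = (\<Sum>t\<in>B. kernel_power B (\<lambda>s t. \<Sum>u\<in>A. U s u * D u t) r s t * U t y)" for s
  have "kernel_power A (\<lambda>x y. \<Sum>s\<in>B. D x s * U s y) (Suc (Suc r)) x y =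
      (\<Sum>u\<in>A. \<Sum>s\<in>B. \<Sum>s'\<in>B. D x s * U s u * (D u s' * V s'))"
    by (subst kernel_power.simps(2), subst Suc.IH) (simp add: V_def[symmetric] sum_product)
  also have "\<dots> = (\<Sum>s\<in>B. \<Sum>s'\<in>B. \<Sum>u\<in>A. D x s * U s u * (D u s' * V s'))"
    by (subst sum.swap) (rule sum.cong[OF refl sum.swap])
  also have "\<dots> = (\<Sum>s\<in>B. D x s * (\<Sum>s'\<in>B. (\<Sum>u\<in>A. U s u * D u s') * V s'))"
    by (simp add: sum_distrib_left sum_distrib_right mult_ac)
  also have "\<dots> = (\<Sum>s\<in>B. D x s * (\<Sum>t\<in>B. kernel_power B (\<lambda>s t. \<Sum>u\<in>A. U s u * D u t) (Suc r) s t * U t y))"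
  proof -
    have "(\<Sum>s'\<in>B. (\<Sum>u\<in>A. U s u * D u s') * V s') =
      (\<Sum>t\<in>B. kernel_power B (\<lambda>s t. \<Sum>u\<in>A. U s u * D u t) (Suc r) s t * U t y)" for s
      unfolding V_def kernel_power.simps(2) sum_distrib_left sum_distrib_right
      by (subst sum.swap) (simp only: mult.assoc)
    then show ?thesis by simp
  qed
  finally show ?case .
qed

text \<open>A power of a L + b I is a polynomial in L with nonnegative coefficients. Only their
  existence matters later, so the binomial formula is avoided. They do not depend on the
  states.\<close>

lemma kernel_power_affine:
  fixes K L :: "'a \<Rightarrow> 'a \<Rightarrow> real"
  assumes fin: "finite S" and ab: "a \<ge> 0" "b \<ge> 0"
    and K: "\<And>x y. x \<in> S \<Longrightarrow> y \<in> S \<Longrightarrow> K x y = a * L x y + b * of_bool (x = y)"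
  shows "\<exists>c. (\<forall>k. c k \<ge> 0) \<and>
    (\<forall>x\<in>S. \<forall>y\<in>S. kernel_power S K r x y = (\<Sum>k\<le>r. c k * kernel_power S L k x y))"
proof (induction r)
  case 0
  show ?case by (rule exI[of _ "\<lambda>_. 1"]) simp
next
  case (Suc r)
  then obtain c where c: "\<And>k. c k \<ge> (0::real)" and
    IH: "\<And>x y. x \<in> S \<Longrightarrow> y \<in> S \<Longrightarrow> kernel_power S K r x y = (\<Sum>k\<le>r. c k * kernel_power S L k x y)"
    by blast
  \<comment> \<open>Multiplication of the polynomial by a L + b I: coefficients shifted by one
    degree, times \<open>a\<close>, plus the old ones, times \<open>b\<close>. The test
    \<open>k \<le> r\<close> discards \<open>c (Suc r)\<close>, about which only nonnegativity is
    known.\<close>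
  define c' where "c' k = a * (if k = 0 then 0 else c (k - 1)) + b * (if k \<le> r then c k else 0)" for k
  have "kernel_power S K (Suc r) x y = (\<Sum>k\<le>Suc r. c' k * kernel_power S L k x y)"
    if x: "x \<in> S" and y: "y \<in> S" for x y
  proof -
    have "kernel_power S K (Suc r) x y =
        (\<Sum>u\<in>S. a * (L x u * kernel_power S K r u y) + (if u = x then b * kernel_power S K r u y else 0))"
      unfolding kernel_power.simps(2)
      by (rule sum.cong) (auto simp: K[OF x] algebra_simps)
    also have "\<dots> = a * (\<Sum>u\<in>S. L x u * kernel_power S K r u y) + b * kernel_power S K r x y"
      using fin x by (simp add: sum.distrib sum_distrib_left)
    also have "(\<Sum>u\<in>S. L x u * kernel_power S K r u y) =
        (\<Sum>u\<in>S. \<Sum>k\<le>r. c k * (L x u * kernel_power S L k u y))"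
      by (rule sum.cong) (simp_all add: IH[OF _ y] sum_distrib_left mult_ac)
    also have "\<dots> = (\<Sum>k\<le>r. c k * kernel_power S L (Suc k) x y)"
      by (subst sum.swap) (simp add: sum_distrib_left)
    finally have "kernel_power S K (Suc r) x y = a * (\<Sum>k\<le>r. c k * kernel_power S L (Suc k) x y) +
        b * (\<Sum>k\<le>r. c k * kernel_power S L k x y)"
      by (simp only: IH[OF x y])
    moreover have "(\<Sum>k\<le>Suc r. a * (if k = 0 then 0 else c (k - 1)) * kernel_power S L k x y) =
        a * (\<Sum>k\<le>r. c k * kernel_power S L (Suc k) x y)"
      by (subst sum.atMost_Suc_shift) (simp add: sum_distrib_left mult_ac)
    moreover have "(\<Sum>k\<le>Suc r. b * (if k \<le> r then c k else 0) * kernel_power S L k x y) =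
        b * (\<Sum>k\<le>r. c k * kernel_power S L k x y)"
      by (simp add: sum_distrib_left mult_ac)
    ultimately show ?thesis
      unfolding c'_def distrib_right sum.distrib by simp
  qed
  moreover have "c' k \<ge> 0" for k using c ab by (simp add: c'_def)
  ultimately show ?case by (intro exI[of _ c']) blast
qed

section \<open>The pair of states realising the separation\<close>

definition row_diagram :: "nat \<Rightarrow> box set" where
  "row_diagram n = {0} \<times> {..<n}"

definition column_diagram :: "nat \<Rightarrow> box set" where
  "column_diagram n = {..<n} \<times> {0}"

lemma row_diagram_partition: "row_diagram n \<in> partitions_of n"
  by (auto simp: row_diagram_def partitions_of_def young_diagram_def card_cartesian_product)

lemma column_diagram_partition: "column_diagram n \<in> partitions_of n"
  by (auto simp: column_diagram_def partitions_of_def young_diagram_def card_cartesian_product)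

lemma down_prob_row:
  assumes "\<tau> \<in> partitions_of n"
  shows "down_prob (row_diagram (Suc n)) \<tau> = of_bool (\<tau> = row_diagram n)"
proof -
  have "row_diagram (Suc n) - {(0, n)} = row_diagram n" by (auto simp: row_diagram_def)
  then show ?thesis
    using down_prob_deterministic[OF row_diagram_partition _ _ assms, of "(0, n)"]
    by (auto simp: row_diagram_def)
qed

lemma down_prob_column:
  assumes "\<tau> \<in> partitions_of n"
  shows "down_prob (column_diagram (Suc n)) \<tau> = of_bool (\<tau> = column_diagram n)"
proof -
  have "column_diagram (Suc n) - {(n, 0)} = column_diagram n" by (auto simp: column_diagram_def)
  then show ?thesis
    using down_prob_deterministic[OF column_diagram_partition _ _ assms, of "(n, 0)"]
    by (auto simp: column_diagram_def)
qed

text \<open>The maximal separation distance is one minus the minimum of this density over all pairs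
  of states.\<close>

definition density_UD :: "complex \<Rightarrow> complex \<Rightarrow> nat \<Rightarrow> nat \<Rightarrow> box set \<Rightarrow> box set \<Rightarrow> real" where
  "density_UD z z' n r x y =
     kernel_power (partitions_of n) (down_up z z' n) r x y / z_measure z z' n y"

definition density_DU :: "complex \<Rightarrow> complex \<Rightarrow> nat \<Rightarrow> nat \<Rightarrow> box set \<Rightarrow> box set \<Rightarrow> real" where
  "density_DU z z' n r x y =
     kernel_power (partitions_of n) (up_down z z' n) r x y / z_measure z z' n y"

text \<open>The power factors as D (U D)^r U, and detailed balance turns the final up step into a
  down step out of \<open>y\<close>; the result averages over down steps from both
  endpoints.\<close>

lemma density_UD_Suc:
  assumes adm: "admissible z z'" and y: "y \<in> partitions_of (Suc n)"
  shows "density_UD z z' (Suc n) (Suc r) x y =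
    (\<Sum>s\<in>partitions_of n. down_prob x s *
      (\<Sum>t\<in>partitions_of n. down_prob y t * density_DU z z' n r s t))"
proof -
  have du: "down_up z z' (Suc n) = (\<lambda>x y. \<Sum>s\<in>partitions_of n. down_prob x s * up_prob z z' n s y)"
    by (simp add: fun_eq_iff down_up_def)
  have ud: "up_down z z' n = (\<lambda>s t. \<Sum>u\<in>partitions_of (Suc n). up_prob z z' n s u * down_prob u t)"
    by (simp add: fun_eq_iff up_down_def)
  have "density_UD z z' (Suc n) (Suc r) x y =
    (\<Sum>s\<in>partitions_of n. down_prob x s * (\<Sum>t\<in>partitions_of n.
      kernel_power (partitions_of n) (up_down z z' n) r s t *
      (up_prob z z' n t y / z_measure z z' (Suc n) y)))"
    unfolding density_UD_def du ud
    by (subst kernel_power_factor[OF finite_partitions_of finite_partitions_of y])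
      (simp only: sum_divide_distrib times_divide_eq_right[symmetric])
  also have "\<dots> = (\<Sum>s\<in>partitions_of n. down_prob x s *
      (\<Sum>t\<in>partitions_of n. down_prob y t * density_DU z z' n r s t))"
    by (intro sum.cong refl arg_cong[of _ _ "(*) _"])
      (simp add: detailed_balance[OF adm _ y] density_DU_def)
  finally show ?thesis .
qed

text \<open>Down steps out of a row and a column are deterministic, so the double average collapses
  to a single term.\<close>

lemma density_UD_corner:
  assumes adm: "admissible z z'"
  shows "density_UD z z' (Suc n) (Suc r) (row_diagram (Suc n)) (column_diagram (Suc n)) =
    density_DU z z' n r (row_diagram n) (column_diagram n)"
  using row_diagram_partition[of n] column_diagram_partition[of n]
  by (simp add: density_UD_Suc[OF adm column_diagram_partition] down_prob_row down_prob_column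
      finite_partitions_of of_bool_def if_distrib if_distribR cong: if_cong)

lemma weighted_average_ge:
  fixes w f :: "'a \<Rightarrow> real"
  assumes "\<And>s. s \<in> S \<Longrightarrow> w s \<ge> 0" "sum w S = 1" "\<And>s. s \<in> S \<Longrightarrow> m \<le> f s"
  shows "m \<le> (\<Sum>s\<in>S. w s * f s)"
proof -
  have "m = (\<Sum>s\<in>S. w s * m)" using assms(2) by (simp flip: sum_distrib_right)
  also have "\<dots> \<le> (\<Sum>s\<in>S. w s * f s)" using assms by (intro sum_mono mult_left_mono) auto
  finally show ?thesis .
qed

lemma density_UD_lower:
  assumes adm: "admissible z z'"
    and x: "x \<in> partitions_of (Suc n)" and y: "y \<in> partitions_of (Suc n)"
    and m: "\<And>s t. s \<in> partitions_of n \<Longrightarrow> t \<in> partitions_of n \<Longrightarrow> m \<le> density_DU z z' n r s t"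
  shows "m \<le> density_UD z z' (Suc n) (Suc r) x y"
  unfolding density_UD_Suc[OF adm y]
  by (intro weighted_average_ge down_prob_nonneg sum_down_prob x y m)

text \<open>The coefficients are nonnegative and common to all pairs of states, so a pair minimising
  every \<open>density_UD\<close> on the right also minimises \<open>density_DU\<close>.\<close>

lemma density_DU_expansion:
  assumes adm: "admissible z z'"
  obtains c where "\<And>k. c k \<ge> (0::real)"
    "\<And>x y. x \<in> partitions_of (Suc n) \<Longrightarrow> y \<in> partitions_of (Suc n) \<Longrightarrow>
      density_DU z z' (Suc n) r x y = (\<Sum>k\<le>r. c k * density_UD z z' (Suc n) k x y)"
proof -
  let ?t = "content_weight z z' 0"
  have t: "?t > 0" by (rule content_weight_pos[OF adm])
  have "Suc n * (?t + n) / ((Suc n + 1) * (?t + Suc n)) \<ge> 0"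
    "(?t + 2 * Suc n) / ((Suc n + 1) * (?t + Suc n)) \<ge> 0"
    using t by simp_all
  from kernel_power_affine[OF finite_partitions_of[of "Suc n"] this commutation_relation[OF adm], of r]
  obtain c where "\<And>k. c k \<ge> (0::real)"
    "\<And>x y. x \<in> partitions_of (Suc n) \<Longrightarrow> y \<in> partitions_of (Suc n) \<Longrightarrow>
      kernel_power (partitions_of (Suc n)) (up_down z z' (Suc n)) r x y =
      (\<Sum>k\<le>r. c k * kernel_power (partitions_of (Suc n)) (down_up z z' (Suc n)) k x y)"
    by blast
  then show thesis
    by (intro that[of c]) (simp_all add: density_DU_def density_UD_def sum_divide_distrib)
qed

lemma density_DU_minimum:
  assumes adm: "admissible z z'"
    and "x \<in> partitions_of (Suc n)" "y \<in> partitions_of (Suc n)"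
  shows "density_DU z z' (Suc n) r (row_diagram (Suc n)) (column_diagram (Suc n)) \<le>
    density_DU z z' (Suc n) r x y"
  using assms(2,3)
\<comment> \<open>The exponent is generalised because the expansion of one power on a level calls on
  several smaller powers on the level below.\<close>
proof (induction n arbitrary: r x y)
  case 0
  \<comment> \<open>The first level has a single state, at once row and column.\<close>
  have "\<mu> = {(0, 0)}" if "\<mu> \<in> partitions_of (Suc 0)" for \<mu>
  proof -
    obtain i j where "\<mu> = {(i, j)}"
      using \<open>\<mu> \<in> _\<close> by (auto simp: partitions_of_def card_1_singleton_iff)
    then show ?thesis using young_diagramD[OF partitions_ofD[OF that], of i j 0 0] by auto
  qed
  then have "x = row_diagram (Suc 0)" "y = column_diagram (Suc 0)"
    using "0" row_diagram_partition[of "Suc 0"] column_diagram_partition[of "Suc 0"] by metis+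
  then show ?case by simp
next
  case (Suc n)
  let ?R = "row_diagram (Suc (Suc n))" and ?C = "column_diagram (Suc (Suc n))"
  have RC: "?R \<in> partitions_of (Suc (Suc n))" "?C \<in> partitions_of (Suc (Suc n))"
    by (rule row_diagram_partition column_diagram_partition)+
  have "density_UD z z' (Suc (Suc n)) k ?R ?C \<le> density_UD z z' (Suc (Suc n)) k x y" for k
  proof (cases k)
    case 0
    \<comment> \<open>From the second level on, row and column differ, so the zeroth power has
      density 0 at this pair, the least possible value.\<close>
    have "(0, 1) \<in> ?R" "(0, 1) \<notin> ?C" by (auto simp: row_diagram_def column_diagram_def)
    then have "?R \<noteq> ?C" by metis
    then show ?thesis
      using z_measure_pos[OF adm Suc.prems(2)] by (simp add: 0 density_UD_def)
  next
    case (Suc l)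
    show ?thesis
      \<comment> \<open>The corner value equals the density at the row and column one level below,
        which is minimal there by induction; averaging cannot go below it.\<close>
      unfolding Suc density_UD_corner[OF adm]
      by (rule density_UD_lower[OF adm Suc.prems Suc.IH])
  qed
  moreover obtain c where "\<And>k. c k \<ge> (0::real)"
    "\<And>x y. x \<in> partitions_of (Suc (Suc n)) \<Longrightarrow> y \<in> partitions_of (Suc (Suc n)) \<Longrightarrow>
      density_DU z z' (Suc (Suc n)) r x y = (\<Sum>k\<le>r. c k * density_UD z z' (Suc (Suc n)) k x y)"
    using density_DU_expansion[OF adm] by blast
  ultimately show ?case
    using RC Suc.prems by (simp add: sum_mono mult_left_mono)
qed

lemma max_separation_eqI:
  assumes "finite S" "x \<in> S" "y \<in> S"
    and "\<And>u v. u \<in> S \<Longrightarrow> v \<in> S \<Longrightarrow>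
      kernel_power S K r x y / \<pi> y \<le> kernel_power S K r u v / \<pi> v"
  shows "max_separation S K \<pi> r = 1 - kernel_power S K r x y / \<pi> y"
  unfolding max_separation_def
  using assms by (intro Max_eqI) (auto intro!: image_eqI[of _ _ "(x, y)"])

theorem proposition5p7:
  fixes z z' :: complex and n r :: nat
  assumes "admissible z z'" and "n \<ge> 1"
  shows "sep_DU z z' n r = sep_UD z z' (n + 1) (r + 1)"
proof -
  obtain k where n: "n = Suc k" using assms(2) by (cases n) auto
  note min = density_DU_minimum[OF assms(1), of _ k, folded n]
  have "sep_DU z z' n r = 1 - density_DU z z' n r (row_diagram n) (column_diagram n)"
    unfolding sep_DU_def density_DU_def
    by (intro max_separation_eqI finite_partitions_of row_diagram_partition
        column_diagram_partition min[unfolded density_DU_def])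
  moreover have "sep_UD z z' (Suc n) (Suc r) =
      1 - density_UD z z' (Suc n) (Suc r) (row_diagram (Suc n)) (column_diagram (Suc n))"
    unfolding sep_UD_def density_UD_def
  proof (intro max_separation_eqI finite_partitions_of row_diagram_partition
      column_diagram_partition, fold density_UD_def)
    fix u v assume "u \<in> partitions_of (Suc n)" "v \<in> partitions_of (Suc n)"
    then show "density_UD z z' (Suc n) (Suc r) (row_diagram (Suc n)) (column_diagram (Suc n)) \<le>
        density_UD z z' (Suc n) (Suc r) u v"
      \<comment> \<open>The corner value is the minimum of \<open>density_DU\<close> on level
        \<open>n\<close>, hence a lower bound for every average of that density.\<close>
      unfolding density_UD_corner[OF assms(1)]
      by (rule density_UD_lower[OF assms(1)]) (rule min)
  qed
  ultimately show ?thesis by (simp add: density_UD_corner[OF assms(1)])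
qed

end
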